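(* For all non-negative integers $r,n$, the Lucas analogue of the generalized FiboCatalan number, $$J_{\{r\}}\,\frac{\{2n\}!}{\{n\}!\,\{n+r+1\}!},\qquad\text{where } J_{\{r\}}=\frac{\{2r+1\}!}{\{r\}!},$$ is a polynomial in $s$ and $t$ with non-negative integer coefficients.
   Context: The Lucas polynomials $\{n\}$ in two variables $s,t$ are defined by $\{0\}=0$, $\{1\}=1$, and $\{n\}=s\{n-1\}+t\{n-2\}$ for $n\ge 2$. For $n\ge 1$, $\{n\}!=\{n\}\{n-1\}\cdots\{2\}\{1\}$, and $\{0\}!=1$ (empty product). Quotients are a priori taken in the field of rational functions $\mathbb{Q}(s,t)$. *)

theory Defs
  imports "HOL-Computational_Algebra.Computational_Algebra"
begin

text \<open>
  The ring \<open>\<rat>[s,t]\<close> is rendered as \<open>\<rat>[t][s]\<close>, i.e. the type \<^typ>\<open>rat poly poly\<close>: the outer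
  variable is \<open>s\<close>, the inner one is \<open>t\<close>, and \<open>coeff (coeff p i) j\<close> is the coefficient of
  \<open>s\<^sup>i t\<^sup>j\<close> in \<open>p\<close>.  Its field of fractions \<^typ>\<open>rat poly poly fract\<close> is \<open>\<rat>(s,t)\<close>.
\<close>

definition var_s :: "rat poly poly" where
  "var_s = [:0, 1:]"

definition var_t :: "rat poly poly" where
  "var_t = [:[:0, 1:]:]"

fun lucas :: "nat \<Rightarrow> rat poly poly" where
  "lucas 0 = 0"
| "lucas (Suc 0) = 1"
| "lucas (Suc (Suc n)) = var_s * lucas (Suc n) + var_t * lucas n"

definition lucas_fact :: "nat \<Rightarrow> rat poly poly" where
  "lucas_fact n = (\<Prod>k = 1..n. lucas k)"

definition lucas_J :: "nat \<Rightarrow> rat poly poly fract" where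
  "lucas_J r = to_fract (lucas_fact (2 * r + 1)) / to_fract (lucas_fact r)"

definition lucas_fibocatalan :: "nat \<Rightarrow> nat \<Rightarrow> rat poly poly fract" where
  "lucas_fibocatalan r n =
     lucas_J r * (to_fract (lucas_fact (2 * n)) /
                  (to_fract (lucas_fact n) * to_fract (lucas_fact (n + r + 1))))"

text \<open>Note that \<^term>\<open>\<nat> :: rat set\<close> is the set of non-negative integers inside \<open>\<rat>\<close>.\<close>

definition nonneg_int_polynomial :: "rat poly poly fract \<Rightarrow> bool" where
  "nonneg_int_polynomial x \<longleftrightarrow>
     (\<exists>p :: rat poly poly. x = to_fract p \<and> (\<forall>i j. coeff (coeff p i) j \<in> \<nat>))"

text \<open>
  All denominators above are nonzero, so the convention \<open>x / 0 = 0\<close> plays no role.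
\<close>

lemma poly_lucas_pos: "poly (poly (lucas (Suc n)) 1) 1 > 0"
proof -
  have "poly (poly (lucas n) 1) 1 \<ge> 0 \<and> poly (poly (lucas (Suc n)) 1) 1 > 0"
    by (induction n) (auto simp: var_s_def var_t_def)
  then show ?thesis by simp
qed

lemma lucas_nonzero: "n \<ge> 1 \<Longrightarrow> lucas n \<noteq> 0"
  using poly_lucas_pos[of "n - 1"] by auto

lemma lucas_fact_nonzero: "to_fract (lucas_fact n) \<noteq> 0"
  by (simp add: lucas_fact_def lucas_nonzero)

end

theory Submission
  imports Defs
begin

text \<open>
  Over \<open>\<real>\<close> the Lucas polynomial \<open>{n}\<close> is the product, over the fractions \<open>x = k/n\<close> with
  \<open>0 < x \<le> 1/2\<close>, of the factors \<open>s\<^sup>2 + 4 cos\<^sup>2(\<pi>x) t\<close> (replaced by \<open>s\<close> for \<open>x = 1/2\<close>), which have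
  nonnegative coefficients.  A fraction with reduced denominator \<open>d\<close> occurs \<open>\<lfloor>m/d\<rfloor>\<close> times in
  \<open>{m}!\<close>, and
  \<open>\<lfloor>r/d\<rfloor> + \<lfloor>n/d\<rfloor> + \<lfloor>(n+r+1)/d\<rfloor> \<le> \<lfloor>(2r+1)/d\<rfloor> + \<lfloor>2n/d\<rfloor>\<close>,
  so the quotient is a real polynomial with nonnegative coefficients.  They are integers because
  the denominator is monic in \<open>s\<close> with coefficients in \<open>\<int>[t]\<close>.
\<close>

section \<open>Lucas sequences\<close>

text \<open>General coefficients make one recursion serve for numerical values and for polynomials
  over the integers, rationals and reals; homomorphisms carry one instance to another.\<close>

fun lucas_seq :: "'a::comm_ring_1 \<Rightarrow> 'a \<Rightarrow> nat \<Rightarrow> 'a" where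
  "lucas_seq s t 0 = 0"
| "lucas_seq s t (Suc 0) = 1"
| "lucas_seq s t (Suc (Suc n)) = s * lucas_seq s t (Suc n) + t * lucas_seq s t n"

lemma lucas_seq_hom:
  assumes "h 0 = 0" "h 1 = 1" "\<And>x y. h (x + y) = h x + h y" "\<And>x y. h (x * y) = h x * h y"
  shows "h (lucas_seq s t n) = lucas_seq (h s) (h t) n"
  by (induction n rule: induct_nat_012) (simp_all add: assms)

lemma lucas_seq_monic:
  "degree (lucas_seq [:0, 1:] [:c:] (Suc n)) = n \<and>
   lead_coeff (lucas_seq [:0, 1:] [:c:] (Suc n)) = (1 :: 'a::comm_ring_1)"
proof -
  \<comment> \<open>The bound is stated for index \<open>n\<close> itself, so that it covers the
    zero polynomial at \<open>n = 0\<close> and removes the contribution of \<open>c\<close> to the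
    top coefficient.\<close>
  have le: "coeff (lucas_seq [:0, 1:] [:c:] n) k = 0" if "k \<ge> n" for k n
    using that
    by (induction n arbitrary: k rule: induct_nat_012) (auto simp: coeff_pCons split: nat.split)
  have top: "coeff (lucas_seq [:0, 1:] [:c:] (Suc n)) n = 1" for n
  proof (induction n)
    case (Suc n)
    then show ?case by (simp add: le)
  qed simp
  have "degree (lucas_seq [:0, 1:] [:c:] (Suc n)) = n"
    by (rule antisym; (rule degree_le le_degree)) (auto simp: top intro!: le)
  then show ?thesis by (simp only: top)
qed

text \<open>With s = 2u cos \<theta> and t = -u^2 the recursion is that of the Chebyshev polynomials
  of the second kind, scaled by powers of u. The factor \<open>sin \<theta>\<close> stays on the
  left to avoid a division.\<close>

lemma lucas_seq_sin:
  "lucas_seq (2 * u * cos \<theta>) (- (u\<^sup>2)) (Suc n) * sin \<theta> = u ^ n * sin (real (Suc n) * \<theta>)"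
proof (induction n rule: induct_nat_012)
  case 0
  then show ?case by simp
next
  case 1
  then show ?case by (simp add: sin_double)
next
  case (ge2 n)
  have "sin (real (n + 3) * \<theta>) + sin (real (n + 1) * \<theta>) = 2 * cos \<theta> * sin (real (n + 2) * \<theta>)"
  proof -
    have "real (n + 3) * \<theta> = real (n + 2) * \<theta> + \<theta>" "real (n + 1) * \<theta> = real (n + 2) * \<theta> - \<theta>"
      by (simp_all add: algebra_simps)
    then show ?thesis by (simp only: sin_add sin_diff) simp
  qed
  then have *: "sin (real (Suc (Suc (Suc n))) * \<theta>)
      = 2 * cos \<theta> * sin (real (Suc (Suc n)) * \<theta>) - sin (real (Suc n) * \<theta>)"
    by (simp add: algebra_simps numeral_3_eq_3)
  have "lucas_seq (2 * u * cos \<theta>) (- (u\<^sup>2)) (Suc (Suc (Suc n))) * sin \<theta>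
      = 2 * u * cos \<theta> * (lucas_seq (2 * u * cos \<theta>) (- (u\<^sup>2)) (Suc (Suc n)) * sin \<theta>)
        - u\<^sup>2 * (lucas_seq (2 * u * cos \<theta>) (- (u\<^sup>2)) (Suc n) * sin \<theta>)"
    by (simp only: lucas_seq.simps(3)) (simp add: algebra_simps)
  also have "\<dots> = u ^ Suc (Suc n) * sin (real (Suc (Suc (Suc n))) * \<theta>)"
    unfolding ge2.IH * by (simp add: algebra_simps power2_eq_square)
  finally show ?case .
qed

text \<open>The difference of two monic polynomials of degree \<open>card A\<close> has smaller
  degree, so it cannot vanish on all of \<open>A\<close> unless it is zero.\<close>

lemma monic_eq_prod_roots:
  fixes p :: "'a::idom poly"
  assumes "finite A" "degree p = card A" "lead_coeff p = 1" "\<And>a. a \<in> A \<Longrightarrow> poly p a = 0"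
  shows "p = (\<Prod>a\<in>A. [:- a, 1:])"
proof (rule ccontr)
  define q where "q = (\<Prod>a\<in>A. [:- a, 1:])"
  assume "p \<noteq> (\<Prod>a\<in>A. [:- a, 1:])"
  then have nz: "p - q \<noteq> 0" by (simp add: q_def)
  have dq: "degree q = card A" by (simp add: q_def degree_prod_sum_eq)
  have lq: "lead_coeff q = 1" by (simp add: q_def lead_coeff_prod)
  have "degree (p - q) \<le> card A" using assms(2) dq by (simp add: degree_diff_le)
  moreover have "coeff (p - q) (card A) = 0" using assms(2,3) dq lq by simp
  ultimately have deg: "degree (p - q) < card A"
    using nz by (metis leading_coeff_0_iff le_neq_implies_less)
  have "A \<subseteq> {x. poly (p - q) x = 0}"
    using assms(1,4) by (auto simp: q_def poly_prod intro!: prod_zero)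
  then have "card A \<le> card {x. poly (p - q) x = 0}"
    by (intro card_mono poly_roots_finite nz)
  also have "\<dots> \<le> degree (p - q)" by (rule card_poly_roots_bound[OF nz])
  finally show False using deg by simp
qed

section \<open>Fractions with a given denominator\<close>

text \<open>These index the roots 2u cos(pi k/n) of {n}. Fractions need not be reduced, so one real
  number can lie in many of these sets.\<close>

definition fracs :: "nat \<Rightarrow> real set" where
  "fracs n = (\<lambda>k. real k / real n) ` {1..<n}"

text \<open>One representative of each pair x, 1 - x.\<close>

definition half_fracs :: "nat \<Rightarrow> real set" where
  "half_fracs n = {x \<in> fracs n. x \<le> 1/2}"

lemma finite_fracs [simp]: "finite (fracs n)" "finite (half_fracs n)"
  by (simp_all add: fracs_def half_fracs_def)

lemma card_fracs: "card (fracs n) = n - 1"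
  unfolding fracs_def by (subst card_image) (auto simp: inj_on_def)

lemma fracs_bounds: "x \<in> fracs n \<Longrightarrow> 0 < x \<and> x < 1"
  by (auto simp: fracs_def)

lemma half_fracs_bounds: "x \<in> half_fracs n \<Longrightarrow> 0 < x \<and> x \<le> 1/2"
  by (auto simp: half_fracs_def dest: fracs_bounds)

lemma fracs_reflect: "x \<in> fracs n \<Longrightarrow> 1 - x \<in> fracs n"
proof -
  assume "x \<in> fracs n"
  then obtain k where k: "k \<in> {1..<n}" "x = real k / real n" by (auto simp: fracs_def)
  then have "1 - x = real (n - k) / real n" by (simp add: of_nat_diff field_simps)
  moreover have "n - k \<in> {1..<n}" using k by auto
  ultimately show ?thesis unfolding fracs_def by blast
qed

text \<open>\<open>d\<close> is the denominator of \<open>x\<close> in lowest terms.\<close>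

lemma fracs_denominator:
  assumes "x \<in> fracs n"
  obtains d where "d > 0" "\<And>k. k > 0 \<Longrightarrow> x \<in> fracs k \<longleftrightarrow> d dvd k"
proof -
  have x: "0 < x" "x < 1" using fracs_bounds[OF assms] by auto
  have "x \<in> \<rat>" using assms by (auto simp: fracs_def)
  then obtain a d where "d \<noteq> 0" "\<bar>x\<bar> = real a / real d" and cop: "coprime a d"
    by (rule Rats_abs_nat_div_natE)
  with x have d: "d \<noteq> 0" "x = real a / real d" by simp_all
  have "x \<in> fracs k \<longleftrightarrow> d dvd k" if k: "k > 0" for k
  proof
    assume "x \<in> fracs k"
    then obtain j where "x = real j / real k" by (auto simp: fracs_def)
    with d k have "real (j * d) = real (a * k)" by (simp add: field_simps)
    then have "d dvd a * k" using of_nat_eq_iff dvd_triv_right by metis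
    with cop show "d dvd k" by (simp add: coprime_commute coprime_dvd_mult_right_iff)
  next
    assume "d dvd k"
    then obtain e where e: "k = d * e" by blast
    have "x = real (a * e) / real k" using d e k by simp
    moreover have "0 < a" "a < d" using d x by (auto simp: zero_less_divide_iff)
    then have "a * e \<in> {1..<k}" using e k by (auto simp: Suc_le_eq)
    ultimately show "x \<in> fracs k" unfolding fracs_def by blast
  qed
  with d(1) show ?thesis using that by blast
qed

text \<open>The reflection x -> 1 - x pairs the fractions on either side of its only fixed point
  1/2.\<close>

lemma prod_fracs_fold:
  fixes g :: "real \<Rightarrow> 'a::comm_monoid_mult"
  assumes "\<And>x. x \<in> fracs n \<Longrightarrow> g (1 - x) = g x"
  shows "(\<Prod>x\<in>fracs n. g x) = (\<Prod>x\<in>half_fracs n. if x = 1/2 then g x else g x * g x)"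
proof -
  define U where "U = {x \<in> fracs n. x > 1/2}"
  have "fracs n = half_fracs n \<union> U" "half_fracs n \<inter> U = {}"
    by (auto simp: half_fracs_def U_def)
  then have "(\<Prod>x\<in>fracs n. g x) = (\<Prod>x\<in>half_fracs n. g x) * (\<Prod>x\<in>U. g x)"
    by (metis prod.union_disjoint finite_fracs finite_Un)
  also have "(\<Prod>x\<in>U. g x) = (\<Prod>x\<in>half_fracs n - {1/2}. g x)"
    by (rule prod.reindex_bij_witness[of _ "\<lambda>x. 1 - x" "\<lambda>x. 1 - x"])
       (auto simp: U_def half_fracs_def assms fracs_reflect)
  also have "\<dots> = (\<Prod>x\<in>half_fracs n. if x = 1/2 then 1 else g x)"
    by (rule prod.mono_neutral_cong_left) auto
  also have "(\<Prod>x\<in>half_fracs n. g x) * \<dots> = (\<Prod>x\<in>half_fracs n. g x * (if x = 1/2 then 1 else g x))"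
    by (simp add: prod.distrib)
  finally show ?thesis by (simp add: if_distrib cong: if_cong)
qed

section \<open>Factorization of the Lucas polynomials over the reals\<close>

definition lucas_poly :: "nat \<Rightarrow> 'a::comm_ring_1 poly poly" where
  "lucas_poly = lucas_seq [:0, 1:] [:[:0, 1:]:]"

text \<open>By the sine formula, each 2u cos(pi k/n) is a root in s. These are n - 1 distinct
  numbers, as cos is injective on [0, pi] and u > 0, so they exhaust a monic polynomial of degree n
  - 1.\<close>

lemma lucas_seq_neg_square:
  fixes s u :: real
  assumes "n > 0" "u > 0"
  shows "lucas_seq s (- (u\<^sup>2)) n = (\<Prod>x\<in>fracs n. s - 2 * u * cos (pi * x))"
proof -
  obtain m where n: "n = Suc m" using assms by (cases n) auto
  define p where "p = lucas_seq [:0, 1:] [:- (u\<^sup>2):] n"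
  have ev: "poly p y = lucas_seq y (- (u\<^sup>2)) n" for y
    unfolding p_def by (subst lucas_seq_hom[where h = "\<lambda>p. poly p y"]) simp_all
  have inj: "inj_on (\<lambda>x. 2 * u * cos (pi * x)) (fracs n)"
    using assms by (auto intro!: inj_onI dest!: fracs_bounds cos_inj_pi[rotated 4])
  have root: "poly p (2 * u * cos (pi * x)) = 0" if x: "x \<in> fracs n" for x
  proof -
    obtain k where k: "x = real k / real n" using x by (auto simp: fracs_def)
    then have "real n * (pi * x) = real k * pi" using assms by simp
    then have "sin (real n * (pi * x)) = 0" by (simp only: sin_npi)
    moreover have "sin (pi * x) \<noteq> 0"
      using fracs_bounds[OF x] sin_gt_zero[of "pi * x"] by simp
    ultimately show ?thesis
      using lucas_seq_sin[of u "pi * x" m] by (simp add: ev n)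
  qed
  have "p = (\<Prod>a\<in>(\<lambda>x. 2 * u * cos (pi * x)) ` fracs n. [:- a, 1:])"
  proof (rule monic_eq_prod_roots)
    show "degree p = card ((\<lambda>x. 2 * u * cos (pi * x)) ` fracs n)"
      using lucas_seq_monic[of "- (u\<^sup>2)" m] by (simp add: card_image[OF inj] card_fracs p_def n[symmetric]) (simp add: n)
    show "lead_coeff p = 1"
      using lucas_seq_monic[of "- (u\<^sup>2)" m] unfolding p_def n by blast
  qed (auto intro: root)
  also have "\<dots> = (\<Prod>x\<in>fracs n. [:- (2 * u * cos (pi * x)), 1:])"
    by (simp add: prod.reindex[OF inj])
  finally have "poly p s = (\<Prod>x\<in>fracs n. s - 2 * u * cos (pi * x))"
    by (simp add: poly_prod)
  then show ?thesis by (simp add: ev)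
qed

text \<open>Reflection flips the sign of the cosine, so the product may be written with either sign.
  Multiplying both forms leaves only u^2 = -t, at the cost of a square.\<close>

lemma lucas_seq_neg_square_squared:
  fixes s u :: real
  assumes "n > 0" "u > 0"
  shows "(lucas_seq s (- (u\<^sup>2)) n)\<^sup>2 = (\<Prod>x\<in>fracs n. s\<^sup>2 - 4 * (cos (pi * x))\<^sup>2 * u\<^sup>2)"
proof -
  have "(\<Prod>x\<in>fracs n. s - 2 * u * cos (pi * x)) = (\<Prod>x\<in>fracs n. s + 2 * u * cos (pi * x))"
    by (rule prod.reindex_bij_witness[of _ "\<lambda>x. 1 - x" "\<lambda>x. 1 - x"])
       (auto simp: fracs_reflect cos_diff right_diff_distrib)
  then have "(lucas_seq s (- (u\<^sup>2)) n)\<^sup>2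
      = (\<Prod>x\<in>fracs n. (s - 2 * u * cos (pi * x)) * (s + 2 * u * cos (pi * x)))"
    by (simp only: lucas_seq_neg_square[OF assms] power2_eq_square[of "prod _ _"] prod.distrib)
  then show ?thesis by (simp add: algebra_simps power2_eq_square)
qed

text \<open>For fixed s the difference, as a polynomial in t, has the infinitely many roots -u^2 and
  is zero. Then \<open>p - q\<close> has infinitely many constant roots \<open>[:s:]\<close> in its
  outer variable.\<close>

lemma poly_poly_eqI:
  fixes p q :: "real poly poly"
  assumes "\<And>s u. u > 0 \<Longrightarrow> poly (poly p [:s:]) (- (u\<^sup>2)) = poly (poly q [:s:]) (- (u\<^sup>2))"
  shows "p = q"
proof -
  have inf_t: "infinite ((\<lambda>u. - (u\<^sup>2)) ` {0<..} :: real set)"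
    by (subst finite_image_iff) (auto simp: inj_on_def infinite_Ioi)
  have "poly (p - q) [:s:] = 0" for s
  proof (rule ccontr)
    assume "poly (p - q) [:s:] \<noteq> 0"
    from poly_roots_finite[OF this] have "finite ((\<lambda>u. - (u\<^sup>2)) ` {0<..} :: real set)"
      by (rule finite_subset[rotated]) (auto simp: assms)
    with inf_t show False by simp
  qed
  moreover have "infinite (range (\<lambda>s::real. [:s:]))"
    by (subst finite_image_iff) (auto simp: inj_on_def infinite_UNIV_char_0)
  ultimately have "p - q = 0"
    using poly_roots_finite[of "p - q"] by (metis (mono_tags) finite_subset image_subsetI mem_Collect_eq)
  then show ?thesis by simp
qed

definition quad_factor :: "real \<Rightarrow> real poly poly" where
  "quad_factor x = [:[:0, 4 * (cos (pi * x))\<^sup>2:], 0, 1:]"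

text \<open>At 1/2 the quadratic factor degenerates to s^2, and its square root s is taken
  instead.\<close>

definition lucas_factor :: "real \<Rightarrow> real poly poly" where
  "lucas_factor x = (if x = 1/2 then [:0, 1:] else quad_factor x)"

lemma poly_poly_lucas_poly:
  "poly (poly (lucas_poly n) [:s:]) t = lucas_seq s t n"
  unfolding lucas_poly_def
  by (subst lucas_seq_hom[where h = "\<lambda>p. poly (poly p [:s:]) t"]) simp_all

lemma lucas_poly_eq_prod:
  assumes "n > 0"
  shows "lucas_poly n = (\<Prod>x\<in>half_fracs n. lucas_factor x)" (is "?L = ?R")
proof -
  have half_sq: "quad_factor (1/2) = [:0, 1:] * [:0, 1:]"
    by (simp add: quad_factor_def)
  \<comment> \<open>Both sides agree at all t = -u^2 with u > 0, which suffices for equality of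
    polynomials.\<close>
  have "?L ^ 2 = (\<Prod>x\<in>fracs n. quad_factor x)"
  proof (rule poly_poly_eqI)
    fix s u :: real assume "u > 0"
    then show "poly (poly (?L ^ 2) [:s:]) (- (u\<^sup>2))
        = poly (poly (\<Prod>x\<in>fracs n. quad_factor x) [:s:]) (- (u\<^sup>2))"
      by (simp add: poly_poly_lucas_poly lucas_seq_neg_square_squared assms poly_prod
            quad_factor_def mult_ac power2_eq_square[of s])
  qed
  also have "\<dots> = (\<Prod>x\<in>half_fracs n. if x = 1/2 then quad_factor x else quad_factor x * quad_factor x)"
    by (rule prod_fracs_fold) (simp add: quad_factor_def cos_diff right_diff_distrib)
  also have "\<dots> = (\<Prod>x\<in>half_fracs n. lucas_factor x ^ 2)"
  proof (rule prod.cong[OF refl])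
    fix x
    show "(if x = 1/2 then quad_factor x else quad_factor x * quad_factor x) = lucas_factor x ^ 2"
      by (cases "x = 1/2", hypsubst) (simp_all add: lucas_factor_def half_sq power2_eq_square)
  qed
  also have "\<dots> = ?R ^ 2" by (simp add: prod_power_distrib)
  finally have "?L = ?R \<or> ?L = - ?R" by (simp add: power2_eq_iff)
  \<comment> \<open>Equality of squares leaves a sign, fixed at s = t = 1: there the left side is
    nonnegative and the product positive.\<close>
  moreover have "?L \<noteq> - ?R"
  proof
    assume "?L = - ?R"
    then have eq: "lucas_seq 1 1 n = - poly (poly ?R [:1:]) 1"
      using poly_poly_lucas_poly[of n 1 "1 :: real"] by simp
    have "lucas_seq 1 (1 :: real) k \<ge> 0" for k
      by (induction k rule: induct_nat_012) auto
    moreover have "poly (poly ?R [:1:]) 1 > 0"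
      unfolding poly_prod
      by (rule prod_pos) (auto simp: lucas_factor_def quad_factor_def add_pos_nonneg)
    ultimately show False using eq by (metis neg_0_le_iff_le not_le)
  qed
  ultimately show ?thesis by blast
qed

section \<open>The exponents of the factors in a product of Lucas factorials\<close>

definition lucas_poly_fact :: "nat \<Rightarrow> 'a::comm_ring_1 poly poly" where
  "lucas_poly_fact m = (\<Prod>k = 1..m. lucas_poly k)"

text \<open>For 0 < x \<le> 1/2 this is the exponent of \<open>lucas_factor x\<close> in
  {m}!.\<close>

definition frac_count :: "nat \<Rightarrow> real \<Rightarrow> nat" where
  "frac_count m x = card {k \<in> {1..m}. x \<in> fracs k}"

lemma card_multiples: "d > 0 \<Longrightarrow> card {k \<in> {1..m}. d dvd k} = m div d" for d m :: nat
proof -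
  assume d: "d > 0"
  have "{k \<in> {1..m}. d dvd k} = (\<lambda>j. d * j) ` {1..m div d}"
    using d by (auto simp: less_eq_div_iff_mult_less_eq mult.commute Suc_le_eq elim!: dvdE intro!: image_eqI)
  then show ?thesis using d by (simp add: card_image inj_on_def)
qed

text \<open>The same \<open>d\<close> serves every \<open>m\<close>, which makes the exponents in
  different factorials comparable.\<close>

lemma frac_count_div:
  assumes "x \<in> fracs n"
  obtains d where "d > 0" "\<And>m. frac_count m x = m div d"
proof -
  from fracs_denominator[OF assms] obtain d where
    d: "d > 0" "\<And>k. k > 0 \<Longrightarrow> x \<in> fracs k \<longleftrightarrow> d dvd k" by blast
  have "{k \<in> {1..m}. x \<in> fracs k} = {k \<in> {1..m}. d dvd k}" for m using d(2) by auto
  with d(1) that[of d] show ?thesis by (simp only: frac_count_def card_multiples)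
qed

text \<open>The bound \<open>M\<close> gives several factorials a common index set; surplus factors
  get exponent 0.\<close>

lemma lucas_poly_fact_eq_prod:
  assumes "m \<le> M"
  shows "lucas_poly_fact m = (\<Prod>x\<in>(\<Union>k\<in>{1..M}. half_fracs k). lucas_factor x ^ frac_count m x)"
proof -
  define X where "X = (\<Union>k\<in>{1..M}. half_fracs k)"
  have fin: "finite X" by (simp add: X_def)
  have "lucas_poly_fact m = (\<Prod>k = 1..m. \<Prod>x\<in>half_fracs k. lucas_factor x)"
    unfolding lucas_poly_fact_def by (rule prod.cong) (auto simp: lucas_poly_eq_prod)
  also have "\<dots> = (\<Prod>k = 1..m. \<Prod>x\<in>X. if x \<in> fracs k then lucas_factor x else 1)"
  proof (rule prod.cong[OF refl])
    fix k assume "k \<in> {1..m}"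
    with assms have "k \<in> {1..M}" by auto
    then show "(\<Prod>x\<in>half_fracs k. lucas_factor x) = (\<Prod>x\<in>X. if x \<in> fracs k then lucas_factor x else 1)"
      by (intro prod.mono_neutral_cong_left fin) (auto simp: X_def half_fracs_def)
  qed
  also have "\<dots> = (\<Prod>x\<in>X. \<Prod>k = 1..m. if x \<in> fracs k then lucas_factor x else 1)"
    by (rule prod.swap)
  also have "\<dots> = (\<Prod>x\<in>X. lucas_factor x ^ frac_count m x)"
    by (simp add: frac_count_def prod.inter_filter[symmetric])
  finally show ?thesis by (simp add: X_def)
qed

lemma fibocatalan_exponent:
  fixes r n d :: nat
  assumes "d > 0"
  shows "r div d + n div d + (n + r + 1) div d \<le> (2 * r + 1) div d + (2 * n) div d"
proof -
  \<comment> \<open>The quotients contribute equally to both sides, so only the remainders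
    \<open>a\<close> and \<open>b\<close> matter.\<close>
  define a b p q where "a = n mod d" and "b = r mod d" and "p = n div d" and "q = r div d"
  have ab: "a < d" "b < d" using assms by (auto simp: a_def b_def)
  have n: "n = a + d * p" and r: "r = b + d * q" by (auto simp: a_def b_def p_def q_def)
  have "n + r + 1 = (a + b + 1) + d * (p + q)" "2 * r + 1 = (2 * b + 1) + d * (2 * q)"
    "2 * n = 2 * a + d * (2 * p)"
    unfolding n r by (simp_all add: algebra_simps)
  then have div: "(n + r + 1) div d = (a + b + 1) div d + p + q"
    "(2 * r + 1) div d = (2 * b + 1) div d + 2 * q" "(2 * n) div d = 2 * a div d + 2 * p"
    using assms by (simp_all only: div_mult_self2[OF less_imp_neq[OF assms, symmetric]])
  have "(a + b + 1) div d \<le> (2 * b + 1) div d + 2 * a div d"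
  proof (cases "a + b + 1 < d")
    case False
    have "(a + b + 1) div d < 2" using ab by (simp add: div_less_iff_less_mult assms)
    \<comment> \<open>The sum of 2b + 1 and 2a is at least 2d - 1, so they cannot both be at most d
      - 1.\<close>
    moreover have "2 * b + 1 \<ge> d \<or> 2 * a \<ge> d" using False by linarith
    then have "(2 * b + 1) div d \<ge> 1 \<or> 2 * a div d \<ge> 1"
      using assms by (auto simp: Suc_le_eq div_greater_zero_iff)
    ultimately show ?thesis by linarith
  qed simp
  then show ?thesis unfolding div p_def[symmetric] q_def[symmetric] by linarith
qed

section \<open>Nonnegativity and integrality of the quotient\<close>

definition nonneg_coeffs :: "real poly poly \<Rightarrow> bool" where
  "nonneg_coeffs p \<longleftrightarrow> (\<forall>i j. coeff (coeff p i) j \<ge> 0)"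

lemma nonneg_coeffs_1: "nonneg_coeffs 1"
  by (simp add: nonneg_coeffs_def coeff_1)

lemma nonneg_coeffs_mult: "nonneg_coeffs p \<Longrightarrow> nonneg_coeffs q \<Longrightarrow> nonneg_coeffs (p * q)"
  by (auto simp: nonneg_coeffs_def coeff_mult coeff_sum intro!: sum_nonneg mult_nonneg_nonneg)

lemma nonneg_coeffs_power: "nonneg_coeffs p \<Longrightarrow> nonneg_coeffs (p ^ k)"
  by (induction k) (auto intro: nonneg_coeffs_1 nonneg_coeffs_mult)

lemma nonneg_coeffs_prod: "(\<And>x. x \<in> A \<Longrightarrow> nonneg_coeffs (f x)) \<Longrightarrow> nonneg_coeffs (prod f A)"
  by (induction A rule: infinite_finite_induct) (auto intro: nonneg_coeffs_1 nonneg_coeffs_mult)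

lemma nonneg_coeffs_lucas_factor: "nonneg_coeffs (lucas_factor x)"
  by (auto simp: nonneg_coeffs_def lucas_factor_def quad_factor_def coeff_pCons split: nat.split)

lemma fibocatalan_real_quotient:
  obtains C where "nonneg_coeffs C"
    "lucas_poly_fact (2 * r + 1) * lucas_poly_fact (2 * n)
      = lucas_poly_fact r * lucas_poly_fact n * lucas_poly_fact (n + r + 1) * C"
proof -
  \<comment> \<open>The bound 2r + 1 + 2n dominates the indices of all five factorials.\<close>
  define X where "X = (\<Union>k\<in>{1..2 * r + 1 + 2 * n}. half_fracs k)"
  define a where "a x = frac_count (2 * r + 1) x + frac_count (2 * n) x" for x
  define b where "b x = frac_count r x + frac_count n x + frac_count (n + r + 1) x" for x
  have le: "b x \<le> a x" if "x \<in> X" for x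
  proof -
    from that obtain k where "x \<in> fracs k" by (auto simp: X_def half_fracs_def)
    then obtain d where "d > 0" "\<And>m. frac_count m x = m div d" using frac_count_div by blast
    then show ?thesis using fibocatalan_exponent[of d r n] by (simp add: a_def b_def)
  qed
  \<comment> \<open>By \<open>le\<close> the truncated subtraction is exact.\<close>
  define C where "C = (\<Prod>x\<in>X. lucas_factor x ^ (a x - b x))"
  have fact: "lucas_poly_fact m = (\<Prod>x\<in>X. lucas_factor x ^ frac_count m x)"
    if "m \<le> 2 * r + 1 + 2 * n" for m
    using lucas_poly_fact_eq_prod[OF that] by (simp add: X_def)
  have "lucas_poly_fact (2 * r + 1) * lucas_poly_fact (2 * n) = (\<Prod>x\<in>X. lucas_factor x ^ a x)"
    by (simp add: fact a_def power_add prod.distrib)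
  also have "\<dots> = (\<Prod>x\<in>X. lucas_factor x ^ b x * lucas_factor x ^ (a x - b x))"
    by (rule prod.cong) (auto simp: le simp flip: power_add)
  also have "\<dots> = lucas_poly_fact r * lucas_poly_fact n * lucas_poly_fact (n + r + 1) * C"
    by (simp add: fact b_def C_def power_add prod.distrib)
  finally show ?thesis
    by (rule that[rotated])
       (auto simp: C_def intro!: nonneg_coeffs_prod nonneg_coeffs_power nonneg_coeffs_lucas_factor)
qed

section \<open>Extension of scalars from the integers, and division by a monic polynomial\<close>

lemma map_poly_mult_hom:
  assumes "f 0 = 0" "\<And>x y. f (x + y) = f x + f y" "\<And>x y. f (x * y) = f x * f y"
  shows "map_poly f (p * q) = map_poly f p * map_poly f q"
proof -
  have "f (sum g A) = (\<Sum>x\<in>A. f (g x))" for g and A :: "nat set"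
    by (induction A rule: infinite_finite_induct) (simp_all add: assms)
  then show ?thesis by (intro poly_eqI) (simp add: coeff_map_poly coeff_mult assms)
qed

definition of_int_poly_poly :: "int poly poly \<Rightarrow> 'a::{comm_ring_1,ring_char_0} poly poly" where
  "of_int_poly_poly = map_poly (map_poly of_int)"

lemma coeff_of_int_poly_poly: "coeff (coeff (of_int_poly_poly p) i) j = of_int (coeff (coeff p i) j)"
  by (simp add: of_int_poly_poly_def coeff_map_poly)

lemma of_int_poly_poly_0: "of_int_poly_poly 0 = 0"
  and of_int_poly_poly_1: "of_int_poly_poly 1 = 1"
  and of_int_poly_poly_add: "of_int_poly_poly (p + q) = of_int_poly_poly p + of_int_poly_poly q"
  by (intro poly_eqI; simp add: coeff_of_int_poly_poly coeff_1)+

lemma of_int_poly_poly_mult: "of_int_poly_poly (p * q) = of_int_poly_poly p * of_int_poly_poly q"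
proof -
  have add: "map_poly of_int (x + y) = (map_poly of_int x + map_poly of_int y :: 'a poly)" for x y
    by (intro poly_eqI) (simp add: coeff_map_poly)
  show ?thesis unfolding of_int_poly_poly_def
    by (intro map_poly_mult_hom add) simp_all
qed

lemma of_int_poly_poly_eq_0_iff: "of_int_poly_poly p = 0 \<longleftrightarrow> p = 0"
  by (auto simp: poly_eq_iff coeff_of_int_poly_poly)

lemma degree_of_int_poly_poly: "degree (of_int_poly_poly p) = degree p"
proof (cases "p = 0")
  case False
  then show ?thesis unfolding of_int_poly_poly_def
    by (intro degree_map_poly) (auto simp: poly_eq_iff coeff_map_poly)
qed (simp add: of_int_poly_poly_0)

lemma of_int_poly_poly_lucas_poly: "of_int_poly_poly (lucas_poly n) = lucas_poly n"
  unfolding lucas_poly_def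
  by (subst lucas_seq_hom[where h = of_int_poly_poly])
     (simp_all add: of_int_poly_poly_0 of_int_poly_poly_1 of_int_poly_poly_add of_int_poly_poly_mult,
      simp add: of_int_poly_poly_def map_poly_pCons)

lemma of_int_poly_poly_lucas_poly_fact: "of_int_poly_poly (lucas_poly_fact m) = lucas_poly_fact m"
  unfolding lucas_poly_fact_def
  by (induction m) (simp_all add: of_int_poly_poly_1 of_int_poly_poly_mult of_int_poly_poly_lucas_poly)

lemma lead_coeff_lucas_poly_fact: "lead_coeff (lucas_poly_fact m) = (1 :: 'a::idom poly)"
proof -
  have "lead_coeff (lucas_poly k) = (1 :: 'a poly)" if "k \<in> {1..m}" for k
    using that lucas_seq_monic[of "[:0, 1 :: 'a:]" "k - 1"] unfolding lucas_poly_def by simp metis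
  then show ?thesis by (simp add: lucas_poly_fact_def lead_coeff_prod)
qed

text \<open>Division by a monic polynomial stays within integer coefficients, and uniqueness of
  quotient and remainder over the reals identifies \<open>C\<close> with the integral
  quotient.\<close>

lemma monic_real_quotient_is_integral:
  fixes A B :: "int poly poly" and C :: "real poly poly"
  assumes monic: "lead_coeff B = 1" and eq: "of_int_poly_poly A = of_int_poly_poly B * C"
  obtains Q where "A = B * Q" "C = of_int_poly_poly Q"
proof -
  have B: "B \<noteq> 0" using monic by auto
  obtain Q R where "pseudo_divmod A B = (Q, R)" by (cases "pseudo_divmod A B")
  \<comment> \<open>Pseudo-division scales \<open>A\<close> by a power of the leading coefficient of
    \<open>B\<close>, which is 1.\<close>
  from pseudo_divmod[OF B this] monic
  have A: "A = B * Q + R" and R: "R = 0 \<or> degree R < degree B" by simp_all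
  let ?h = "of_int_poly_poly :: _ \<Rightarrow> real poly poly"
  have hR: "?h R = ?h B * (C - ?h Q)"
    using eq unfolding A by (simp add: of_int_poly_poly_add of_int_poly_poly_mult algebra_simps)
  have C: "C = ?h Q"
  proof (rule ccontr)
    \<comment> \<open>A nonzero cofactor would give the remainder degree at least that of
      \<open>B\<close>.\<close>
    assume ne: "C \<noteq> ?h Q"
    with B have "degree (?h R) = degree (?h B) + degree (C - ?h Q)"
      unfolding hR by (intro degree_mult_eq) (simp_all add: of_int_poly_poly_eq_0_iff)
    then have "\<not> degree R < degree B" by (simp add: degree_of_int_poly_poly)
    with R have "?h R = 0" by (simp add: of_int_poly_poly_0)
    with hR ne B show False by (simp add: of_int_poly_poly_eq_0_iff)
  qed
  with hR have "R = 0" by (simp add: of_int_poly_poly_eq_0_iff)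
  with A C that[of Q] show ?thesis by simp
qed

section \<open>Passage to rational functions\<close>

lemma lucas_eq_lucas_poly: "lucas n = lucas_poly n"
  unfolding lucas_poly_def by (induction n rule: lucas.induct) (simp_all add: var_s_def var_t_def)

lemma lucas_fact_eq_lucas_poly_fact: "lucas_fact m = lucas_poly_fact m"
  by (simp add: lucas_fact_def lucas_poly_fact_def lucas_eq_lucas_poly)

theorem theorem3:
  fixes r n :: nat
  shows "nonneg_int_polynomial (lucas_fibocatalan r n)"
proof -
  define A :: "int poly poly" where "A = lucas_poly_fact (2 * r + 1) * lucas_poly_fact (2 * n)"
  define B :: "int poly poly" where
    "B = lucas_poly_fact r * lucas_poly_fact n * lucas_poly_fact (n + r + 1)"
  obtain C where C: "nonneg_coeffs C" "of_int_poly_poly A = of_int_poly_poly B * C"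
    using fibocatalan_real_quotient[of r n]
    by (auto simp: A_def B_def of_int_poly_poly_mult of_int_poly_poly_lucas_poly_fact)
  have "lead_coeff B = 1"
    by (simp add: B_def lead_coeff_mult lead_coeff_lucas_poly_fact)
  from monic_real_quotient_is_integral[OF this C(2)] obtain Q where
    Q: "A = B * Q" "C = of_int_poly_poly Q" .
  \<comment> \<open>The integral factorization, obtained through the reals, is now read over the
    rationals.\<close>
  have "of_int_poly_poly A = of_int_poly_poly B * (of_int_poly_poly Q :: rat poly poly)"
    by (simp add: Q(1) of_int_poly_poly_mult)
  then have "lucas_fact (2 * r + 1) * lucas_fact (2 * n)
      = lucas_fact r * lucas_fact n * lucas_fact (n + r + 1) * of_int_poly_poly Q"
    by (simp add: A_def B_def of_int_poly_poly_mult of_int_poly_poly_lucas_poly_fact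
          lucas_fact_eq_lucas_poly_fact)
  then have "to_fract (lucas_fact (2 * r + 1)) * to_fract (lucas_fact (2 * n))
      = to_fract (lucas_fact r) * to_fract (lucas_fact n) * to_fract (lucas_fact (n + r + 1))
        * to_fract (of_int_poly_poly Q)"
    by (simp only: to_fract_mult[symmetric])
  then have "lucas_fibocatalan r n = to_fract (of_int_poly_poly Q)"
    using lucas_fact_nonzero[of r] lucas_fact_nonzero[of n] lucas_fact_nonzero[of "n + r + 1"]
    by (simp add: lucas_fibocatalan_def lucas_J_def divide_simps mult_ac)
  moreover have "coeff (coeff (of_int_poly_poly Q :: rat poly poly) i) j \<in> \<nat>" for i j
  proof -
    \<comment> \<open>The sign of an integer coefficient is read off from its real image in
      \<open>C\<close>.\<close>
    have "coeff (coeff Q i) j \<ge> 0"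
      using C(1) by (simp add: Q(2) nonneg_coeffs_def coeff_of_int_poly_poly)
    then show ?thesis
      by (simp add: coeff_of_int_poly_poly Nats_altdef1)
  qed
  ultimately show ?thesis unfolding nonneg_int_polynomial_def by blast
qed

end
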